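(* Let $G$ be a graph with maximum degree $\Delta$ and minimum degree $\delta$. If $\lambda_1$ and $\rho_1$ are the largest eigenvalues of the diminished Sombor matrix and of the adjacency matrix of $G$, respectively, then $$\frac{\sqrt{2}\,\delta}{\Delta}\,\rho_1\leq\lambda_1\leq\frac{\sqrt{2}\,\Delta}{2\delta}\,\rho_1.$$ Equality holds if and only if $G$ is a regular graph.
   Context: All graphs are simple. For a graph $G$ with vertices $v_1,\dots,v_n$, edge set $E(G)$ and degrees $d_i=d_{v_i}$, the diminished Sombor matrix $M_{DS}(G)=(\mu_{ij})$ is the $n\times n$ real symmetric matrix with $\mu_{ij}=\frac{\sqrt{d_i^2+d_j^2}}{d_i+d_j}$ if $v_iv_j\in E(G)$, and $\mu_{ij}=0$ otherwise. The adjacency matrix is the $n\times n$ matrix whose $(i,j)$ entry is $1$ if $v_iv_j\in E(G)$ and $0$ otherwise.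
   Formalization: The printed lower bound fails for regular graphs with an edge (e.g. K2: √2 ≤ √2/2); the formal statement uses √2·δ/(2Δ)·ρ1 ≤ λ1 instead. The lower bound is stated for Δ > 0, the upper for δ > 0, each with its own equality clause. *)

theory Defs
  imports "Graph_Theory.Digraph" "Jordan_Normal_Form.Spectral_Radius"
begin

text \<open>
  Simple graphs are the instances of the locale \<^locale>\<open>graph\<close>: finite, loopfree, without
  parallel arcs, and symmetric. An undirected edge \<open>uv\<close> is the pair of opposite arcs
  \<open>u \<rightarrow> v\<close> and \<open>v \<rightarrow> u\<close>, so the degree of a vertex is its out-degree.
\<close>

definition max_degree :: "('a, 'b) pre_digraph \<Rightarrow> nat" where
  "max_degree G = Max (out_degree G ` verts G)"

definition min_degree :: "('a, 'b) pre_digraph \<Rightarrow> nat" where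
  "min_degree G = Min (out_degree G ` verts G)"

definition regular_graph :: "('a, 'b) pre_digraph \<Rightarrow> bool" where
  "regular_graph G \<longleftrightarrow> (\<exists>k. \<forall>v\<in>verts G. out_degree G v = k)"

text \<open>
  Both matrices are taken with respect to an enumeration \<open>vs\<close> of the vertices
  without repetition; the vertex \<open>v\<^sub>i\<close> is \<open>vs ! i\<close>, counting from \<open>0\<close>.
\<close>

definition adjacency_matrix :: "('a, 'b) pre_digraph \<Rightarrow> 'a list \<Rightarrow> real mat" where
  "adjacency_matrix G vs = Matrix.mat (length vs) (length vs)
     (\<lambda>(i, j). if vs ! i \<rightarrow>\<^bsub>G\<^esub> vs ! j then 1 else 0)"

definition diminished_sombor_matrix :: "('a, 'b) pre_digraph \<Rightarrow> 'a list \<Rightarrow> real mat" where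
  "diminished_sombor_matrix G vs = Matrix.mat (length vs) (length vs)
     (\<lambda>(i, j). if vs ! i \<rightarrow>\<^bsub>G\<^esub> vs ! j
        then sqrt (real (out_degree G (vs ! i)) ^ 2 + real (out_degree G (vs ! j)) ^ 2)
               / (real (out_degree G (vs ! i)) + real (out_degree G (vs ! j)))
        else 0)"

text \<open>
  Only meant for real symmetric matrices of positive dimension: these have a nonempty
  finite real spectrum, which contains all their complex eigenvalues.
\<close>

definition largest_eigenvalue :: "real mat \<Rightarrow> real" where
  "largest_eigenvalue A = Max (spectrum A)"

end

(* The largest eigenvalue of a symmetric matrix is the maximum of its Rayleigh quotient, so it is
   monotone in the entries of a nonnegative symmetric matrix. Both bounds follow because every
   nonzero entry of the diminished Sombor matrix lies between sqrt 2 / 2 and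
   sqrt 2 * Delta / (delta + Delta). The graph has an edge, so rho1 > 0; as these constants are
   strictly better than the claimed ones unless delta = Delta, equality forces regularity. *)

theory Submission
  imports Defs "HOL-Analysis.Function_Topology"
begin

section \<open>Maximising a quadratic form over the unit sphere\<close>

lemma if_zero_mult: "(if b then x else 0) * y = (if b then x * y else (0::'a::mult_zero))"
  by simp

lemma mult_if_zero: "x * (if b then y else 0) = (if b then x * y else (0::'a::mult_zero))"
  by simp

text \<open>Vectors of length \<open>n\<close> are modelled as functions on all naturals that vanish
  from \<open>n\<close> on. This turns the sphere into a closed subset of a product of compact
  intervals, which is compact by Tychonoff.\<close>

lemma compact_unit_sphere_fun:
  "compact {x :: nat \<Rightarrow> real. (\<Sum>i<n. (x i)\<^sup>2) = 1 \<and> (\<forall>i\<ge>n. x i = 0)}"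
    (is "compact ?S")
proof -
  let ?K = "PiE UNIV (\<lambda>i. if i < n then {-1..1} else {0::real})"
  have "compactin (product_topology (\<lambda>i. euclidean) UNIV) ?K"
    by (subst compactin_PiE) auto
  then have "compact ?K"
    by (simp add: euclidean_product_topology)
  moreover have "closed {x :: nat \<Rightarrow> real. (\<Sum>i<n. (x i)\<^sup>2) = 1}"
    by (intro closed_Collect_eq continuous_intros continuous_on_product_coordinates)
  moreover have "?S = ?K \<inter> {x. (\<Sum>i<n. (x i)\<^sup>2) = 1}"
  proof -
    have "\<bar>x i\<bar> \<le> 1" if "(\<Sum>i<n. (x i)\<^sup>2) = 1" "i < n" for x :: "nat \<Rightarrow> real" and i
    proof -
      have "(x i)\<^sup>2 \<le> (\<Sum>i<n. (x i)\<^sup>2)"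
        using that by (intro member_le_sum) auto
      then show ?thesis
        using that by (simp add: abs_square_le_1)
    qed
    then show ?thesis
      by (auto simp: PiE_def Pi_def abs_le_iff split: if_splits)
  qed
  ultimately show ?thesis
    by (simp only: compact_Int_closed)
qed

text \<open>The coefficients are a function rather than a matrix, so that the form of a shifted
  matrix such as \<open>\<mu> I - A\<close> can be written down directly.\<close>

definition bilinear_form :: "nat \<Rightarrow> (nat \<Rightarrow> nat \<Rightarrow> real) \<Rightarrow> (nat \<Rightarrow> real) \<Rightarrow> (nat \<Rightarrow> real) \<Rightarrow> real"
  where "bilinear_form n a x y = (\<Sum>i<n. \<Sum>j<n. a i j * x i * y j)"

text \<open>Symmetry merges the two cross terms; what matters later is the linear coefficient in
  \<open>t\<close>.\<close>

lemma bilinear_form_add_scaled: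
  assumes "\<And>i j. i < n \<Longrightarrow> j < n \<Longrightarrow> a i j = a j i"
  shows "bilinear_form n a (\<lambda>i. x i + t * y i) (\<lambda>i. x i + t * y i)
    = bilinear_form n a x x + 2 * t * bilinear_form n a y x + t\<^sup>2 * bilinear_form n a y y"
proof -
  have "bilinear_form n a x y = (\<Sum>i<n. \<Sum>j<n. a j i * x j * y i)"
    unfolding bilinear_form_def by (rule sum.swap)
  also have "\<dots> = bilinear_form n a y x"
    unfolding bilinear_form_def using assms by (intro sum.cong) (auto simp: mult_ac)
  finally have sym: "bilinear_form n a x y = bilinear_form n a y x" .
  have "bilinear_form n a (\<lambda>i. x i + t * y i) (\<lambda>i. x i + t * y i)
    = bilinear_form n a x x + t * bilinear_form n a x y + t * bilinear_form n a y x
      + t\<^sup>2 * bilinear_form n a y y"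
    unfolding bilinear_form_def sum_distrib_left sum.distrib[symmetric]
    by (intro sum.cong) (simp_all add: algebra_simps power2_eq_square)
  then show ?thesis
    using sym by simp
qed

text \<open>A parabola through the origin that never goes below zero has slope zero there.\<close>

lemma nonneg_quadratic_imp_linear_coeff_0:
  fixes b c :: real
  assumes "\<And>t. 2 * t * b + t\<^sup>2 * c \<ge> 0"
  shows "b = 0"
proof (rule ccontr)
  assume b: "b \<noteq> 0"
  \<comment> \<open>Since \<open>d\<close> is positive and exceeds \<open>c\<close>, the factor
    \<open>c - 2 * d\<close> is negative, so \<open>t = - b / d\<close> makes the quadratic
    negative.\<close>
  define d where "d = \<bar>c\<bar> + 1"
  have d: "d > 0" "c < d" by (auto simp: d_def)
  have "2 * (- b / d) * b + (- b / d)\<^sup>2 * c = (b\<^sup>2 / d\<^sup>2) * (c - 2 * d)"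
    using d by (simp add: field_simps power2_eq_square)
  also have "\<dots> < 0"
    using b d by (intro mult_pos_neg) auto
  finally show False
    using assms[of "- b / d"] by simp
qed

text \<open>Compactness yields a unit vector maximising the form; homogeneity extends the bound to
  all vectors, and the first-order condition at the maximiser is the eigenvector equation.\<close>

lemma symmetric_form_attains_max:
  fixes a :: "nat \<Rightarrow> nat \<Rightarrow> real"
  assumes n: "n > 0" and sym: "\<And>i j. i < n \<Longrightarrow> j < n \<Longrightarrow> a i j = a j i"
  obtains \<mu> x where "(\<Sum>i<n. (x i)\<^sup>2) = 1"
    and "\<And>i. i < n \<Longrightarrow> (\<Sum>j<n. a i j * x j) = \<mu> * x i"
    and "\<And>y. bilinear_form n a y y \<le> \<mu> * (\<Sum>i<n. (y i)\<^sup>2)"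
proof -
  let ?S = "{x :: nat \<Rightarrow> real. (\<Sum>i<n. (x i)\<^sup>2) = 1 \<and> (\<forall>i\<ge>n. x i = 0)}"
  have "(\<lambda>i. if i = 0 then 1 else 0) \<in> ?S"
    using n by (auto simp: if_distrib[of "\<lambda>c. c\<^sup>2"] cong: if_cong)
  moreover have "continuous_on ?S (\<lambda>x. bilinear_form n a x x)"
  proof -
    have "continuous_on ?S (\<lambda>x. x i)" for i
      by (rule continuous_on_subset[OF continuous_on_product_coordinates subset_UNIV])
    then show ?thesis
      unfolding bilinear_form_def by (intro continuous_intros)
  qed
  ultimately obtain x where xS: "x \<in> ?S"
    and xmax: "\<And>y. y \<in> ?S \<Longrightarrow> bilinear_form n a y y \<le> bilinear_form n a x x"
    using continuous_attains_sup[OF compact_unit_sphere_fun[of n]] by (metis (no_types, lifting) empty_iff)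
  define \<mu> where "\<mu> = bilinear_form n a x x"
  have bound: "bilinear_form n a y y \<le> \<mu> * (\<Sum>i<n. (y i)\<^sup>2)" for y
  proof (cases "(\<Sum>i<n. (y i)\<^sup>2) = 0")
    case True
    then have "\<forall>i<n. y i = 0"
      by (subst (asm) sum_nonneg_eq_0_iff) auto
    then show ?thesis
      using True by (simp add: bilinear_form_def)
  next
    case False
    define r where "r = sqrt (\<Sum>i<n. (y i)\<^sup>2)"
    have r2: "r\<^sup>2 = (\<Sum>i<n. (y i)\<^sup>2)"
      by (simp add: r_def sum_nonneg)
    with False have r0: "r \<noteq> 0" by auto
    \<comment> \<open>Normalising alone does not suffice: \<open>y\<close> is arbitrary beyond
      \<open>n\<close>, so it is also cut off there to land in \<open>?S\<close>.\<close>
    define z where "z i = (if i < n then y i / r else 0)" for i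
    have "(\<Sum>i<n. (z i)\<^sup>2) = (\<Sum>i<n. (y i)\<^sup>2) / r\<^sup>2"
      unfolding sum_divide_distrib by (intro sum.cong) (auto simp: z_def power_divide)
    then have "z \<in> ?S"
      using False r2 by (simp add: z_def)
    then have "bilinear_form n a z z \<le> \<mu>"
      unfolding \<mu>_def by (rule xmax)
    then have "r\<^sup>2 * bilinear_form n a z z \<le> r\<^sup>2 * \<mu>"
      by (rule mult_left_mono) simp
    moreover have "bilinear_form n a y y = r\<^sup>2 * bilinear_form n a z z"
      unfolding bilinear_form_def sum_distrib_left
      using r0 by (intro sum.cong) (auto simp: z_def power2_eq_square)
    ultimately have "bilinear_form n a y y \<le> r\<^sup>2 * \<mu>"
      by simp
    then show ?thesis
      unfolding r2 by (subst mult.commute)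
  qed
  have "(\<Sum>j<n. a k j * x j) = \<mu> * x k" if k: "k < n" for k
  proof -
    \<comment> \<open>The form of \<open>\<mu> I - A\<close> is nonnegative by \<open>bound\<close>
      and zero at \<open>x\<close>. Perturbing \<open>x\<close> by the unit vector \<open>y\<close>
      in direction \<open>k\<close> gives a nonnegative quadratic in \<open>t\<close> without
      constant term; its vanishing linear coefficient is coordinate \<open>k\<close> of
      \<open>\<mu> x - A x\<close>.\<close>
    define y :: "nat \<Rightarrow> real" where "y i = (if i = k then 1 else 0)" for i
    let ?b = "\<lambda>i j. (if i = j then \<mu> else 0) - a i j"
    have form: "bilinear_form n ?b u v = \<mu> * (\<Sum>i<n. u i * v i) - bilinear_form n a u v" for u v
      unfolding bilinear_form_def
      by (simp add: left_diff_distrib sum_subtractf sum_distrib_left if_zero_mult mult.assoc)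
    have "bilinear_form n ?b y x = 0"
    proof (rule nonneg_quadratic_imp_linear_coeff_0)
      fix t :: real
      let ?w = "\<lambda>i. x i + t * y i"
      have "0 \<le> bilinear_form n ?b ?w ?w"
        using bound[of ?w] by (simp add: form power2_eq_square)
      also have "\<dots> = bilinear_form n ?b x x + 2 * t * bilinear_form n ?b y x
          + t\<^sup>2 * bilinear_form n ?b y y"
        by (rule bilinear_form_add_scaled) (use sym in auto)
      also have "bilinear_form n ?b x x = 0"
        using xS by (simp add: form \<mu>_def power2_eq_square)
      finally show "2 * t * bilinear_form n ?b y x + t\<^sup>2 * bilinear_form n ?b y y \<ge> 0"
        by simp
    qed
    moreover have "bilinear_form n a y x = (\<Sum>j<n. a k j * x j)"
      unfolding bilinear_form_def y_def using k
      by (subst sum.swap) (simp add: if_zero_mult mult_if_zero)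
    moreover have "(\<Sum>i<n. y i * x i) = x k"
      unfolding y_def using k by (simp add: if_zero_mult)
    ultimately show ?thesis
      by (simp add: form)
  qed
  with bound xS show ?thesis
    by (intro that[of x \<mu>]) auto
qed

section \<open>The largest eigenvalue as the maximum of the Rayleigh quotient\<close>

text \<open>The maximum \<open>\<mu>\<close> of the form on the unit sphere is an eigenvalue, and no
  eigenvalue exceeds it, because the Rayleigh quotient of an eigenvector is its eigenvalue.\<close>

lemma largest_eigenvalue_symmetric:
  fixes A :: "real mat"
  assumes A: "A \<in> carrier_mat n n" and n: "n > 0"
    and sym: "\<And>i j. i < n \<Longrightarrow> j < n \<Longrightarrow> A $$ (i, j) = A $$ (j, i)"
  shows "\<exists>x. (\<Sum>i<n. (x i)\<^sup>2) = 1 \<and> bilinear_form n (\<lambda>i j. A $$ (i, j)) x x = largest_eigenvalue A"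
    and "bilinear_form n (\<lambda>i j. A $$ (i, j)) y y \<le> largest_eigenvalue A * (\<Sum>i<n. (y i)\<^sup>2)"
proof -
  let ?q = "bilinear_form n (\<lambda>i j. A $$ (i, j))"
  obtain \<mu> x where x1: "(\<Sum>i<n. (x i)\<^sup>2) = 1"
    and ev: "\<And>i. i < n \<Longrightarrow> (\<Sum>j<n. A $$ (i, j) * x j) = \<mu> * x i"
    and bound: "\<And>y. ?q y y \<le> \<mu> * (\<Sum>i<n. (y i)\<^sup>2)"
    by (rule symmetric_form_attains_max[where n = n and a = "\<lambda>i j. A $$ (i, j)"])
      (use n sym that in \<open>blast+\<close>)
  \<comment> \<open>Used twice: for the maximiser \<open>x\<close> and for an arbitrary
    eigenvector.\<close>
  have form_eq: "?q y y = \<nu> * (\<Sum>i<n. (y i)\<^sup>2)"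
    if "\<And>i. i < n \<Longrightarrow> (\<Sum>j<n. A $$ (i, j) * y j) = \<nu> * y i" for y \<nu>
  proof -
    have "?q y y = (\<Sum>i<n. y i * (\<Sum>j<n. A $$ (i, j) * y j))"
      unfolding bilinear_form_def by (simp add: sum_distrib_left mult_ac)
    also have "\<dots> = \<nu> * (\<Sum>i<n. (y i)\<^sup>2)"
      using that by (simp add: sum_distrib_left power2_eq_square mult_ac)
    finally show ?thesis .
  qed
  have "eigenvector A (vec n x) \<mu>"
    unfolding eigenvector_def
  proof (intro conjI)
    show "vec n x \<noteq> 0\<^sub>v (dim_row A)"
    proof
      assume "vec n x = 0\<^sub>v (dim_row A)"
      then have "\<forall>i<n. x i = 0"
        using A by (metis carrier_matD(1) index_vec index_zero_vec(1))
      then show False using x1 by simp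
    qed
    show "A *\<^sub>v vec n x = \<mu> \<cdot>\<^sub>v vec n x"
      using A ev by (intro eq_vecI) (auto simp: scalar_prod_def lessThan_atLeast0)
  qed (use A in auto)
  then have in_spec: "\<mu> \<in> spectrum A"
    by (auto simp: spectrum_def eigenvalue_def)
  have "\<nu> \<le> \<mu>" if "\<nu> \<in> spectrum A" for \<nu>
  proof -
    obtain v where v: "v \<in> carrier_vec n" "v \<noteq> 0\<^sub>v n" "A *\<^sub>v v = \<nu> \<cdot>\<^sub>v v"
      using \<open>\<nu> \<in> spectrum A\<close> A by (auto simp: spectrum_def eigenvalue_def eigenvector_def)
    have "(\<Sum>j<n. A $$ (i, j) * v $ j) = \<nu> * v $ i" if "i < n" for i
      using arg_cong[OF v(3), of "\<lambda>w. w $ i"] A v(1) that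
      by (simp add: scalar_prod_def lessThan_atLeast0)
    then have "\<nu> * (\<Sum>i<n. (v $ i)\<^sup>2) \<le> \<mu> * (\<Sum>i<n. (v $ i)\<^sup>2)"
      using form_eq[of "\<lambda>i. v $ i" \<nu>] bound[of "\<lambda>i. v $ i"] by simp
    moreover have "(\<Sum>i<n. (v $ i)\<^sup>2) > 0"
    proof -
      obtain i where "i < n" "v $ i \<noteq> 0"
        using v(1,2) by (metis carrier_vecD eq_vecI index_zero_vec)
      then show ?thesis
        by (intro sum_pos2[of _ i]) auto
    qed
    ultimately show ?thesis by simp
  qed
  then have top: "largest_eigenvalue A = \<mu>"
    unfolding largest_eigenvalue_def
    using card_finite_spectrum(1)[OF A] in_spec by (intro Max_eqI) auto
  show "\<exists>x. (\<Sum>i<n. (x i)\<^sup>2) = 1 \<and> ?q x x = largest_eigenvalue A"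
    using x1 form_eq[OF ev] top by (intro exI[of _ x]) simp
  show "?q y y \<le> largest_eigenvalue A * (\<Sum>i<n. (y i)\<^sup>2)"
    unfolding top by (rule bound)
qed

text \<open>Replacing a unit maximiser \<open>x\<close> for \<open>A\<close> by its entrywise
  absolute value can only increase the form, as \<open>A\<close> is nonnegative. The products of
  coordinates are then nonnegative too, so the entrywise comparison carries over to the
  forms.\<close>

lemma largest_eigenvalue_mono_scaled:
  fixes A B :: "real mat"
  assumes A: "A \<in> carrier_mat n n" and B: "B \<in> carrier_mat n n" and n: "n > 0"
    and symA: "\<And>i j. i < n \<Longrightarrow> j < n \<Longrightarrow> A $$ (i, j) = A $$ (j, i)"
    and symB: "\<And>i j. i < n \<Longrightarrow> j < n \<Longrightarrow> B $$ (i, j) = B $$ (j, i)"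
    and nonneg: "\<And>i j. i < n \<Longrightarrow> j < n \<Longrightarrow> 0 \<le> A $$ (i, j)"
    and le: "\<And>i j. i < n \<Longrightarrow> j < n \<Longrightarrow> A $$ (i, j) \<le> c * B $$ (i, j)"
    and c: "c \<ge> 0"
  shows "largest_eigenvalue A \<le> c * largest_eigenvalue B"
proof -
  obtain x where x: "(\<Sum>i<n. (x i)\<^sup>2) = 1"
    "bilinear_form n (\<lambda>i j. A $$ (i, j)) x x = largest_eigenvalue A"
    using largest_eigenvalue_symmetric(1)[OF A n symA] by blast
  have "largest_eigenvalue A = bilinear_form n (\<lambda>i j. A $$ (i, j)) x x"
    using x by simp
  also have "\<dots> \<le> c * bilinear_form n (\<lambda>i j. B $$ (i, j)) (\<lambda>i. \<bar>x i\<bar>) (\<lambda>i. \<bar>x i\<bar>)"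
    unfolding bilinear_form_def sum_distrib_left
  proof (intro sum_mono)
    fix i j assume ij: "i \<in> {..<n}" "j \<in> {..<n}"
    have "A $$ (i, j) * x i * x j \<le> A $$ (i, j) * (\<bar>x i\<bar> * \<bar>x j\<bar>)"
      using nonneg[of i j] ij
      by (simp add: mult.assoc mult_left_mono flip: abs_mult)
    also have "\<dots> \<le> (c * B $$ (i, j)) * (\<bar>x i\<bar> * \<bar>x j\<bar>)"
      using le[of i j] ij by (intro mult_right_mono) auto
    finally show "A $$ (i, j) * x i * x j \<le> c * (B $$ (i, j) * \<bar>x i\<bar> * \<bar>x j\<bar>)"
      by (simp add: mult.assoc)
  qed
  also have "\<dots> \<le> c * (largest_eigenvalue B * (\<Sum>i<n. \<bar>x i\<bar>\<^sup>2))"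
    by (rule mult_left_mono[OF largest_eigenvalue_symmetric(2)[OF B n symB] c])
  finally show ?thesis
    using x(1) by simp
qed

text \<open>The all-ones vector is the test vector: its form is the sum of all entries.\<close>

lemma largest_eigenvalue_pos:
  fixes A :: "real mat"
  assumes A: "A \<in> carrier_mat n n"
    and sym: "\<And>i j. i < n \<Longrightarrow> j < n \<Longrightarrow> A $$ (i, j) = A $$ (j, i)"
    and nonneg: "\<And>i j. i < n \<Longrightarrow> j < n \<Longrightarrow> 0 \<le> A $$ (i, j)"
    and pos: "k < n" "l < n" "0 < A $$ (k, l)"
  shows "0 < largest_eigenvalue A"
proof -
  have n: "n > 0" using pos by simp
  have "0 < (\<Sum>j<n. A $$ (k, j))"
    using nonneg pos by (intro sum_pos2[of _ l]) auto
  then have "0 < bilinear_form n (\<lambda>i j. A $$ (i, j)) (\<lambda>_. 1) (\<lambda>_. 1)"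
    unfolding bilinear_form_def
    using nonneg pos by (subst sum_pos2[of _ k]) (auto intro: sum_nonneg)
  also have "\<dots> \<le> largest_eigenvalue A * (\<Sum>i<n. 1\<^sup>2)"
    by (rule largest_eigenvalue_symmetric(2)[OF A n sym])
  finally show ?thesis
    using n by (simp add: zero_less_mult_iff)
qed

section \<open>Bounds on the weight of a single edge\<close>

text \<open>After squaring this is \<open>(a - b)\<^sup>2 \<ge> 0\<close>.\<close>

lemma sqrt_sum_squares_div_sum_ge:
  fixes a b :: real
  assumes "a > 0" "b > 0"
  shows "1 / sqrt 2 \<le> sqrt (a\<^sup>2 + b\<^sup>2) / (a + b)"
proof -
  have "a + b \<le> sqrt 2 * sqrt (a\<^sup>2 + b\<^sup>2)"
    using sum_squares_bound[of a b] unfolding real_sqrt_mult[symmetric]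
    by (intro real_le_rsqrt) (simp add: power2_eq_square algebra_simps)
  then show ?thesis
    using assms by (simp add: field_simps)
qed

text \<open>For \<open>a \<le> b\<close> the root is at most \<open>sqrt 2 * b\<close>, and
  \<open>b / (a + b)\<close> grows with \<open>b\<close> and shrinks with \<open>a\<close>, so it is
  largest at \<open>a = m\<close>, \<open>b = M\<close>. Keeping \<open>m + M\<close> in the
  denominator makes the bound strictly better than \<open>sqrt 2 * M / (2 * m)\<close> when
  \<open>m < M\<close>.\<close>

lemma sqrt_sum_squares_div_sum_le:
  fixes a b m M :: real
  assumes "m > 0" "a \<in> {m..M}" "b \<in> {m..M}"
  shows "sqrt (a\<^sup>2 + b\<^sup>2) / (a + b) \<le> sqrt 2 * M / (m + M)"
  using assms(2,3)
proof (induction a b rule: linorder_wlog)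
  case (le a b)
  have "sqrt (a\<^sup>2 + b\<^sup>2) \<le> sqrt (2 * b\<^sup>2)"
    using le assms(1) by (intro real_sqrt_le_mono) (simp add: power_mono)
  then have "sqrt (a\<^sup>2 + b\<^sup>2) / (a + b) \<le> sqrt 2 * b / (a + b)"
    using le assms(1) by (simp add: real_sqrt_mult divide_right_mono)
  also have "b / (a + b) \<le> M / (m + M)"
  proof -
    have "m * b \<le> a * M"
      using le assms(1) by (intro mult_mono) auto
    then show ?thesis
      using le assms(1) by (simp add: frac_le_eq divide_simps) (simp add: algebra_simps)
  qed
  then have "sqrt 2 * b / (a + b) \<le> sqrt 2 * M / (m + M)"
    using mult_left_mono[of "b / (a + b)" "M / (m + M)" "sqrt 2"] by simp
  finally show ?case .
next
  case (sym a b)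
  then show ?case by (simp add: add.commute)
qed

section \<open>Comparison of the two spectral radii and the equality case\<close>

text \<open>In a regular graph with edges every edge has weight \<open>1 / sqrt 2\<close>, so
  \<open>lambda1 = rho1 / sqrt 2\<close>. Hence the lower constant has the factor 2 in its
  denominator; \<open>sqrt 2 * \<delta> / \<Delta>\<close> would fail there. The guards keep the
  denominators positive: for \<open>\<delta> = 0\<close> the upper bound would read
  \<open>lambda1 \<le> 0\<close>, which is false once there is an edge.\<close>

theorem theorem3p15:
  fixes G :: "('a, 'b) pre_digraph" and vs :: "'a list"
    and \<Delta> \<delta> :: nat and lambda1 rho1 :: real
  assumes "graph G" and "verts G \<noteq> {}"
    and "distinct vs" and "set vs = verts G"
    and "\<Delta> = max_degree G" and "\<delta> = min_degree G"
    and "lambda1 = largest_eigenvalue (diminished_sombor_matrix G vs)"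
    and "rho1 = largest_eigenvalue (adjacency_matrix G vs)"
  shows "(\<Delta> > 0 \<longrightarrow>
            sqrt 2 * real \<delta> / (2 * real \<Delta>) * rho1 \<le> lambda1 \<and>
            (sqrt 2 * real \<delta> / (2 * real \<Delta>) * rho1 = lambda1 \<longleftrightarrow> regular_graph G)) \<and>
         (\<delta> > 0 \<longrightarrow>
            lambda1 \<le> sqrt 2 * real \<Delta> / (2 * real \<delta>) * rho1 \<and>
            (lambda1 = sqrt 2 * real \<Delta> / (2 * real \<delta>) * rho1 \<longleftrightarrow> regular_graph G))"
proof -
  interpret graph G by fact
  define n where "n = length vs"
  have n: "n > 0" using assms(2,4) by (auto simp: n_def)
  let ?A = "adjacency_matrix G vs" and ?S = "diminished_sombor_matrix G vs"
  let ?d = "\<lambda>i. real (out_degree G (vs ! i))"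
  have carrier: "?A \<in> carrier_mat n n" "?S \<in> carrier_mat n n"
    by (auto simp: adjacency_matrix_def diminished_sombor_matrix_def n_def)
  have A: "?A $$ (i, j) = (if vs ! i \<rightarrow>\<^bsub>G\<^esub> vs ! j then 1 else 0)" if "i < n" "j < n" for i j
    using that by (simp add: adjacency_matrix_def n_def)
  have S: "?S $$ (i, j) = (if vs ! i \<rightarrow>\<^bsub>G\<^esub> vs ! j
      then sqrt ((?d i)\<^sup>2 + (?d j)\<^sup>2) / (?d i + ?d j) else 0)" if "i < n" "j < n" for i j
    using that by (simp add: diminished_sombor_matrix_def n_def)
  have adj_sym: "u \<rightarrow>\<^bsub>G\<^esub> v \<longleftrightarrow> v \<rightarrow>\<^bsub>G\<^esub> u" for u v
    using sym_arcs by (auto simp: symmetric_def sym_def)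
  have symA: "?A $$ (i, j) = ?A $$ (j, i)" if "i < n" "j < n" for i j
    using that adj_sym[of "vs ! i" "vs ! j"] by (simp add: A)
  have symS: "?S $$ (i, j) = ?S $$ (j, i)" if "i < n" "j < n" for i j
    using that adj_sym[of "vs ! i" "vs ! j"] by (simp add: S add.commute)
  have nonnegA: "0 \<le> ?A $$ (i, j)" if "i < n" "j < n" for i j
    using that by (simp add: A)
  have nonnegS: "0 \<le> ?S $$ (i, j)" if "i < n" "j < n" for i j
    using that by (simp add: S)
  have deg_bounds: "\<delta> \<le> out_degree G v" "out_degree G v \<le> \<Delta>" if "v \<in> verts G" for v
    using that assms(5,6) by (auto simp: max_degree_def min_degree_def)
  \<comment> \<open>Endpoints of an edge have positive degree even if \<open>\<delta> = 0\<close>,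
    so the lower bound on edge weights, and with it \<open>rho_le\<close>, holds in every
    case.\<close>
  have deg_pos: "out_degree G u > 0" if uv: "u \<rightarrow>\<^bsub>G\<^esub> v" for u v
  proof -
    obtain e where "e \<in> out_arcs G u"
      using uv by (auto simp: arcs_ends_def arc_to_ends_def)
    then show ?thesis
      unfolding out_degree_def using card_gt_0_iff finite_out_arcs by blast
  qed
  have vs_verts: "vs ! i \<in> verts G" if "i < n" for i
    using nth_mem[of i vs] that unfolding n_def assms(4) .
  have regular_iff: "regular_graph G \<longleftrightarrow> \<delta> = \<Delta>"
  proof
    assume "regular_graph G"
    then obtain k where "\<forall>v\<in>verts G. out_degree G v = k"
      by (auto simp: regular_graph_def)
    then have "out_degree G ` verts G = {k}"
      using assms(2) by force
    then show "\<delta> = \<Delta>"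
      by (simp add: assms(5,6) max_degree_def min_degree_def)
  next
    assume "\<delta> = \<Delta>"
    then show "regular_graph G"
      unfolding regular_graph_def using deg_bounds by (metis le_antisym)
  qed
  have \<delta>_le: "\<delta> \<le> \<Delta>"
    using deg_bounds assms(2) by (meson all_not_in_conv le_trans)
  have rho_le: "rho1 \<le> sqrt 2 * lambda1"
    unfolding assms(7,8)
  proof (rule largest_eigenvalue_mono_scaled[OF carrier n symA symS nonnegA])
    fix i j assume ij: "i < n" "j < n"
    show "?A $$ (i, j) \<le> sqrt 2 * ?S $$ (i, j)"
    proof (cases "vs ! i \<rightarrow>\<^bsub>G\<^esub> vs ! j")
      case True
      then have "1 / sqrt 2 \<le> sqrt ((?d i)\<^sup>2 + (?d j)\<^sup>2) / (?d i + ?d j)"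
        using deg_pos adj_sym by (intro sqrt_sum_squares_div_sum_ge) auto
      then show ?thesis
        using ij True by (simp add: A S field_simps)
    qed (simp add: A S ij)
  qed auto
  have lambda_le: "lambda1 \<le> sqrt 2 * real \<Delta> / (real \<delta> + real \<Delta>) * rho1" if "\<delta> > 0"
    unfolding assms(7,8)
  proof (rule largest_eigenvalue_mono_scaled[OF carrier(2,1) n symS symA nonnegS])
    fix i j assume ij: "i < n" "j < n"
    show "?S $$ (i, j) \<le> sqrt 2 * real \<Delta> / (real \<delta> + real \<Delta>) * ?A $$ (i, j)"
      using sqrt_sum_squares_div_sum_le[of "real \<delta>" "?d i" "real \<Delta>" "?d j"] that
        deg_bounds[OF vs_verts] ij
      by (simp add: A S)
  qed auto
  \<comment> \<open>A vertex of maximum degree has an outgoing arc, which gives a positive entry of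
    the adjacency matrix. Strictness in both equality cases rests on this.\<close>
  have rho_pos: "rho1 > 0" if pos: "\<Delta> > 0"
  proof -
    have "\<Delta> \<in> out_degree G ` verts G"
      unfolding assms(5) max_degree_def using assms(2) by (intro Max_in) auto
    then obtain u where "u \<in> verts G" "out_degree G u > 0"
      using pos by auto
    then obtain e where e: "e \<in> arcs G" "tail G e = u"
      by (auto simp: out_degree_def card_gt_0_iff out_arcs_def)
    then have uv: "u \<rightarrow>\<^bsub>G\<^esub> head G e"
      by (auto intro: dominatesI simp: arc_to_ends_def)
    obtain k l where "k < n" "l < n" "vs ! k = u" "vs ! l = head G e"
      using e \<open>u \<in> verts G\<close> assms(4) by (metis head_in_verts in_set_conv_nth n_def)
    then show ?thesis
      unfolding assms(8) using uv
      by (intro largest_eigenvalue_pos[OF carrier(1) symA nonnegA, of k l]) (auto simp: A)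
  qed
  have lower: "sqrt 2 / 2 * rho1 \<le> lambda1"
    using mult_left_mono[OF rho_le, of "sqrt 2 / 2"] by (simp flip: mult.assoc)
  show ?thesis
  proof (intro conjI impI)
    assume pos: "\<Delta> > 0"
    \<comment> \<open>The claimed constant is the sharper \<open>sqrt 2 / 2\<close> of
      \<open>lower\<close>, weakened by the factor \<open>\<delta> / \<Delta>\<close>, which is
      below 1 unless the graph is regular.\<close>
    have eq: "sqrt 2 * real \<delta> / (2 * real \<Delta>) * rho1 = (real \<delta> / real \<Delta>) * (sqrt 2 / 2 * rho1)"
      by (simp add: mult_ac)
    have le: "(real \<delta> / real \<Delta>) * (sqrt 2 / 2 * rho1) \<le> 1 * (sqrt 2 / 2 * rho1)"
      using \<delta>_le pos rho_pos by (intro mult_right_mono) auto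
    then show "sqrt 2 * real \<delta> / (2 * real \<Delta>) * rho1 \<le> lambda1"
      using eq lower by linarith
    show "sqrt 2 * real \<delta> / (2 * real \<Delta>) * rho1 = lambda1 \<longleftrightarrow> regular_graph G"
    proof
      assume *: "sqrt 2 * real \<delta> / (2 * real \<Delta>) * rho1 = lambda1"
      show "regular_graph G"
      proof (rule ccontr)
        assume "\<not> regular_graph G"
        then have "(real \<delta> / real \<Delta>) * (sqrt 2 / 2 * rho1) < 1 * (sqrt 2 / 2 * rho1)"
          using \<delta>_le pos rho_pos regular_iff by (intro mult_strict_right_mono) auto
        then show False
          using * eq lower by linarith
      qed
    next
      assume "regular_graph G"
      then have d: "\<delta> = \<Delta>" using regular_iff by simp
      \<comment> \<open>For \<open>\<delta> = \<Delta>\<close> the constant of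
        \<open>lambda_le\<close> becomes \<open>sqrt 2 / 2\<close>, so it meets \<open>lower\<close>
        and pins down \<open>lambda1\<close>.\<close>
      then have "lambda1 \<le> sqrt 2 / 2 * rho1"
        using lambda_le pos by simp
      then show "sqrt 2 * real \<delta> / (2 * real \<Delta>) * rho1 = lambda1"
        using lower eq d pos by simp
    qed
  next
    assume pos: "\<delta> > 0"
    then have rho: "rho1 > 0" using rho_pos \<delta>_le by simp
    \<comment> \<open>This compares \<open>2 * \<delta>\<close> with
      \<open>\<delta> + \<Delta>\<close>; the gap between them is what rules out equality for
      irregular graphs.\<close>
    have frac: "sqrt 2 * real \<Delta> / (real \<delta> + real \<Delta>) \<le> sqrt 2 * real \<Delta> / (2 * real \<delta>)"
      using pos \<delta>_le by (intro divide_left_mono) auto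
    then have "sqrt 2 * real \<Delta> / (real \<delta> + real \<Delta>) * rho1 \<le> sqrt 2 * real \<Delta> / (2 * real \<delta>) * rho1"
      using rho by (intro mult_right_mono) auto
    then show "lambda1 \<le> sqrt 2 * real \<Delta> / (2 * real \<delta>) * rho1"
      using lambda_le pos by linarith
    show "lambda1 = sqrt 2 * real \<Delta> / (2 * real \<delta>) * rho1 \<longleftrightarrow> regular_graph G"
    proof
      assume *: "lambda1 = sqrt 2 * real \<Delta> / (2 * real \<delta>) * rho1"
      show "regular_graph G"
      proof (rule ccontr)
        assume "\<not> regular_graph G"
        then have "sqrt 2 * real \<Delta> / (real \<delta> + real \<Delta>) < sqrt 2 * real \<Delta> / (2 * real \<delta>)"
          using pos \<delta>_le regular_iff by (intro divide_strict_left_mono) auto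
        then have "sqrt 2 * real \<Delta> / (real \<delta> + real \<Delta>) * rho1 < sqrt 2 * real \<Delta> / (2 * real \<delta>) * rho1"
          using rho by (intro mult_strict_right_mono) auto
        then show False
          using * lambda_le pos by linarith
      qed
    next
      assume "regular_graph G"
      then have d: "\<delta> = \<Delta>" using regular_iff by simp
      then have "lambda1 \<le> sqrt 2 / 2 * rho1"
        using lambda_le pos by simp
      then show "lambda1 = sqrt 2 * real \<Delta> / (2 * real \<delta>) * rho1"
        using lower d pos by simp
    qed
  qed
qed

end
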